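(* Suppose that Assumption 1 and Assumption 2(ii) (both stated in the context) hold. Then every sequence $\{(x^k,y^k,z^k)\}_{k\ge 0}$ generated by the PL-ADMM algorithm is bounded.
   Context: Setting. $A\in\mathbb R^{p\times n}$, $B\in\mathbb R^{p\times m}$, $c\in\mathbb R^p$; $A^*,B^*$ are the transposes; $\|\cdot\|$ is the Euclidean norm (operator norm for matrices); $\|v\|_Q^2=\langle v,Qv\rangle$ for symmetric $Q$. $f:\mathbb R^n\to\mathbb R\cup\{+\infty\}$ is proper; $g:\mathbb R^n\to\mathbb R$ and $h:\mathbb R^m\to\mathbb R$ are differentiable; none is assumed convex. The problem is $\min_{x,y} f(x)+g(x)+h(y)$ subject to $Ax+By+c=0$. For $\alpha>0$, $\mathcal L^{\alpha}(x,y,z)=f(x)+g(x)+h(y)+\langle z,Ax+By+c\rangle+\frac{\alpha}{2}\|Ax+By+c\|^2$, $z\in\mathbb R^p$. PL-ADMM algorithm. Given symmetric positive semidefinite matrices $Q_1^k\in\mathbb R^{n\times n}$, $Q_2^k\in\mathbb R^{m\times m}$ ($k\ge0$) and $(x^0,y^0,z^0)$, for $k\ge 0$: $x^{k+1}\in\arg\min_x\{ f(x)+\langle\nabla g(x^k)+\alpha A^*(Ax^k+By^k+c+\alpha^{-1}z^k),x-x^k\rangle+\frac12\|x-x^k\|^2_{Q_1^k}\}$, $y^{k+1}=\arg\min_y\{\langle\nabla h(y^k)+B^*z^k,y-y^k\rangle+\frac{\alpha}{2}\|By+Ax^{k+1}+c\|^2+\frac12\|y-y^k\|^2_{Q_2^k}\}$,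 $z^{k+1}=z^k+\alpha\beta(Ax^{k+1}+By^{k+1}+c)$. Write $\Delta u^{k}=u^{k}-u^{k-1}$ for $k\ge1$. Assumption 1. (A1) $f$ is lower semicontinuous and coercive; (A2) $g$ is coercive and $h$ is bounded from below; (A3) $B$ has full column rank (so $B^*B$ is invertible), ${\rm Im}(A)\subseteq{\rm Im}(B)$ and $c\in{\rm Im}(B)$; (A4) $\nabla g$ and $\nabla h$ are Lipschitz continuous with constants $L_g$ and $L_h$; (A5) $\alpha>0$, $\beta\in(0,2)$, $q_i^-:=\inf_{k\ge0}\|Q_i^k\|\ge0$ and $q_i:=\sup_{k\ge0}\|Q_i^k\|<+\infty$, $i=1,2$. Constants. $\lambda_{\max}^{X}$ and $\lambda_+^{X}$ are the largest and the smallest positive eigenvalue of $X$. $\theta_0=\frac{2\beta(L_h+q_2)^2}{\alpha\lambda_+^{B^*B}(1-|1-\beta|)^2}$, $\theta_1=\frac{2\beta q_2^2}{\alpha\lambda_+^{B^*B}(1-|1-\beta|)^2}$, $\gamma_0=\frac{|1-\beta|}{\alpha\beta\lambda_+^{B^*B}(1-|1-\beta|)}$. For a fixed $r>1$, $\mathcal R(x,y,z,y',z')=\mathcal L^\alpha(x,y,z)+r\gamma_0\|B^*(z-z')\|^2+r\theta_0\|y-y'\|^2$ and $\mathcal R_k=\mathcal R(x^k,y^k,z^k,y^{k-1},z^{k-1})$ for $k\ge1$. Assumption 2(ii) (relaxed sufficient decrease condition). The parameters $\alpha>0$, $\beta\in(0,2)$, $r>1$ and the matrices $Q_1^k,Q_2^k$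 are such that for some $k_0\ge1$ and $\sigma>0$, $\inf_{k\ge k_0}\{\|Q_1^k\|-\alpha\lambda_{\max}^{A^*A}-L_g,\ \|Q_2^k\|+\alpha\lambda_+^{B^*B}-(L_h+r\theta_0+r\theta_1),\ \frac{r-1}{\alpha\beta}\}>\sigma$, and with this the sufficient decrease inequality $\mathcal R_{k+1}+\sigma(\|\Delta x^{k+1}\|^2+\|\Delta y^{k+1}\|^2+\|\Delta z^{k+1}\|^2)\le\mathcal R_k\le\mathcal R_{k_0}$ holds for all $k\ge k_0$. *)

theory Defs
  imports "HOL-Analysis.Analysis"
begin

text \<open>The operator norm induced by the Euclidean norm.\<close>

definition mat_norm :: "real ^ 'n ^ 'm \<Rightarrow> real"
  where "mat_norm M = onorm ((*v) M)"

definition sym_psd :: "real ^ 'n ^ 'n \<Rightarrow> bool"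
  where "sym_psd Q \<longleftrightarrow> transpose Q = Q \<and> (\<forall>v. 0 \<le> v \<bullet> (Q *v v))"

definition sqnorm_mat :: "real ^ 'n ^ 'n \<Rightarrow> real ^ 'n \<Rightarrow> real"
  where "sqnorm_mat Q v = v \<bullet> (Q *v v)"

text \<open>Only real eigenvalues are considered; this loses nothing for the symmetric matrices to
  which the notion is applied.\<close>

definition eigvals :: "real ^ 'n ^ 'n \<Rightarrow> real set"
  where "eigvals M = {l. \<exists>v. v \<noteq> 0 \<and> M *v v = l *\<^sub>R v}"

definition lambda_max :: "real ^ 'n ^ 'n \<Rightarrow> real"
  where "lambda_max M = Max (eigvals M)"

definition lambda_plus :: "real ^ 'n ^ 'n \<Rightarrow> real"
  where "lambda_plus M = Min {l \<in> eigvals M. 0 < l}"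

text \<open>Meaningful only at points where \<open>g\<close> is differentiable.\<close>

definition grad :: "('a::euclidean_space \<Rightarrow> real) \<Rightarrow> 'a \<Rightarrow> 'a"
  where "grad g x = (THE D. GDERIV g x :> D)"

definition argmin :: "('a \<Rightarrow> 'b::linorder) \<Rightarrow> 'a set"
  where "argmin F = {u. is_arg_min F (\<lambda>_. True) u}"

text \<open>Extended-real-valued functions never taking the value \<open>-\<infinity>\<close> model functions into
  the reals extended by \<open>+\<infinity>\<close>.\<close>

definition proper :: "('a \<Rightarrow> ereal) \<Rightarrow> bool"
  where "proper f \<longleftrightarrow> (\<forall>x. f x \<noteq> -\<infinity>) \<and> (\<exists>x. f x \<noteq> \<infinity>)"

definition lsc :: "('a::topological_space \<Rightarrow> ereal) \<Rightarrow> bool"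
  where "lsc f \<longleftrightarrow> (\<forall>x. f x \<le> Liminf (at x) f)"

text \<open>Coercivity: the value tends to \<open>+\<infinity>\<close> as the norm of the argument does.  A real-valued
  \<open>g\<close> is coercive iff \<open>\<lambda>x. ereal (g x)\<close> is.\<close>

definition coercive :: "('a::real_normed_vector \<Rightarrow> ereal) \<Rightarrow> bool"
  where "coercive f \<longleftrightarrow> (f \<longlongrightarrow> \<infinity>) at_infinity"

definition residual ::
    "real ^ 'n ^ 'p \<Rightarrow> real ^ 'm ^ 'p \<Rightarrow> real ^ 'p \<Rightarrow> real ^ 'n \<Rightarrow> real ^ 'm \<Rightarrow> real ^ 'p"
  where "residual A B c x y = A *v x + B *v y + c"

definition aug_lagrangian ::
    "real ^ 'n ^ 'p \<Rightarrow> real ^ 'm ^ 'p \<Rightarrow> real ^ 'p \<Rightarrow>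
     (real ^ 'n \<Rightarrow> ereal) \<Rightarrow> (real ^ 'n \<Rightarrow> real) \<Rightarrow> (real ^ 'm \<Rightarrow> real) \<Rightarrow> real \<Rightarrow>
     real ^ 'n \<Rightarrow> real ^ 'm \<Rightarrow> real ^ 'p \<Rightarrow> ereal"
  where "aug_lagrangian A B c f g h \<alpha> x y z =
    f x + ereal (g x + h y + z \<bullet> residual A B c x y + \<alpha> / 2 * (norm (residual A B c x y))\<^sup>2)"

definition pl_admm ::
    "real ^ 'n ^ 'p \<Rightarrow> real ^ 'm ^ 'p \<Rightarrow> real ^ 'p \<Rightarrow>
     (real ^ 'n \<Rightarrow> ereal) \<Rightarrow> (real ^ 'n \<Rightarrow> real) \<Rightarrow> (real ^ 'm \<Rightarrow> real) \<Rightarrow> real \<Rightarrow> real \<Rightarrow>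
     (nat \<Rightarrow> real ^ 'n ^ 'n) \<Rightarrow> (nat \<Rightarrow> real ^ 'm ^ 'm) \<Rightarrow>
     (nat \<Rightarrow> real ^ 'n) \<Rightarrow> (nat \<Rightarrow> real ^ 'm) \<Rightarrow> (nat \<Rightarrow> real ^ 'p) \<Rightarrow> bool"
  where "pl_admm A B c f g h \<alpha> \<beta> Q1 Q2 x y z \<longleftrightarrow>
    (\<forall>k.
      x (Suc k) \<in> argmin (\<lambda>u. f u + ereal (
          (grad g (x k) + \<alpha> *\<^sub>R (transpose A *v (residual A B c (x k) (y k) + inverse \<alpha> *\<^sub>R z k)))
            \<bullet> (u - x k)
          + 1 / 2 * sqnorm_mat (Q1 k) (u - x k))) \<and>
      {y (Suc k)} = argmin (\<lambda>v.
          (grad h (y k) + transpose B *v z k) \<bullet> (v - y k)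
          + \<alpha> / 2 * (norm (residual A B c (x (Suc k)) v))\<^sup>2
          + 1 / 2 * sqnorm_mat (Q2 k) (v - y k)) \<and>
      z (Suc k) = z k + (\<alpha> * \<beta>) *\<^sub>R residual A B c (x (Suc k)) (y (Suc k)))"

definition theta0 :: "real ^ 'm ^ 'p \<Rightarrow> real \<Rightarrow> real \<Rightarrow> real \<Rightarrow> real \<Rightarrow> real"
  where "theta0 B \<alpha> \<beta> Lh q2 =
    2 * \<beta> * (Lh + q2)\<^sup>2 / (\<alpha> * lambda_plus (transpose B ** B) * (1 - \<bar>1 - \<beta>\<bar>)\<^sup>2)"

definition theta1 :: "real ^ 'm ^ 'p \<Rightarrow> real \<Rightarrow> real \<Rightarrow> real \<Rightarrow> real"
  where "theta1 B \<alpha> \<beta> q2 =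
    2 * \<beta> * q2\<^sup>2 / (\<alpha> * lambda_plus (transpose B ** B) * (1 - \<bar>1 - \<beta>\<bar>)\<^sup>2)"

definition gamma0 :: "real ^ 'm ^ 'p \<Rightarrow> real \<Rightarrow> real \<Rightarrow> real"
  where "gamma0 B \<alpha> \<beta> =
    \<bar>1 - \<beta>\<bar> / (\<alpha> * \<beta> * lambda_plus (transpose B ** B) * (1 - \<bar>1 - \<beta>\<bar>))"

definition regularized_lagrangian ::
    "real ^ 'n ^ 'p \<Rightarrow> real ^ 'm ^ 'p \<Rightarrow> real ^ 'p \<Rightarrow>
     (real ^ 'n \<Rightarrow> ereal) \<Rightarrow> (real ^ 'n \<Rightarrow> real) \<Rightarrow> (real ^ 'm \<Rightarrow> real) \<Rightarrow>
     real \<Rightarrow> real \<Rightarrow> real \<Rightarrow> real \<Rightarrow> real \<Rightarrow>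
     real ^ 'n \<Rightarrow> real ^ 'm \<Rightarrow> real ^ 'p \<Rightarrow> real ^ 'm \<Rightarrow> real ^ 'p \<Rightarrow> ereal"
  where "regularized_lagrangian A B c f g h \<alpha> \<beta> r Lh q2 x y z y' z' =
    aug_lagrangian A B c f g h \<alpha> x y z
    + ereal (r * gamma0 B \<alpha> \<beta> * (norm (transpose B *v (z - z')))\<^sup>2
             + r * theta0 B \<alpha> \<beta> Lh q2 * (norm (y - y'))\<^sup>2)"

end

theory Submission
  imports Defs
begin

text \<open>
  Write \<open>\<rho>\<^sub>k = A x\<^sub>k + B y\<^sub>k + c = B u\<^sub>k\<close> and \<open>a = \<alpha> \<lambda>\<^sub>+(B\<^sup>* B)\<close>.  The optimality condition of the
  \<open>y\<close>-step expresses \<open>B\<^sup>* z\<^sub>k\<close>, and hence \<open>\<langle>z\<^sub>k, \<rho>\<^sub>k\<rangle> = \<langle>B\<^sup>* z\<^sub>k, u\<^sub>k\<rangle>\<close>, through \<open>\<nabla>h\<close>, \<open>\<Delta>y\<^sub>k\<close>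
  and \<open>B\<^sup>* \<rho>\<^sub>k\<close>.  The \<open>\<gamma>\<^sub>0\<close>-term of the regularized Lagrangian absorbs the contribution of \<open>B\<^sup>* \<rho>\<^sub>k\<close>,
  the \<open>\<theta>\<^sub>0\<close>-term that of \<open>\<Delta>y\<^sub>k\<close>, and \<open>\<parallel>\<nabla>h\<parallel>\<^sup>2 \<le> a (h - inf h)\<close> controls the gradient, because the parameter
  condition forces \<open>2 L\<^sub>h \<le> a\<close>.  This bounds the regularized Lagrangian from below by
  \<open>f(x\<^sub>k) + g(x\<^sub>k) + inf h + (a / 8) \<parallel>u\<^sub>k\<parallel>\<^sup>2\<close>.  As it is also bounded above along the iterates, coercivity
  bounds \<open>x\<^sub>k\<close>, and \<open>u\<^sub>k\<close> is bounded; full column rank of \<open>B\<close> then bounds \<open>y\<^sub>k\<close>, and the formula for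
  \<open>B\<^sup>* z\<^sub>k\<close> bounds \<open>z\<^sub>k\<close>, which moves only inside \<open>z\<^sub>0 + Im B\<close>.
\<close>

subsection \<open>Symmetric and Gram matrices\<close>

text \<open>For small t of sign opposite to \<open>a\<close> the linear term outweighs the quadratic
  one. This replaces differentiation in both first-order arguments below.\<close>

lemma quadratic_nonneg_imp_linear_zero:
  fixes a b :: real
  assumes "\<And>t. 0 \<le> t * a + t\<^sup>2 * b"
  shows "a = 0"
proof (rule ccontr)
  assume "a \<noteq> 0"
  define s where "s = \<bar>b\<bar> + 1"
  have s: "s > 0" "b - s < 0" by (auto simp: s_def)
  have "0 \<le> (- a / s) * a + (- a / s)\<^sup>2 * b" by (rule assms)
  also have "\<dots> = a\<^sup>2 * (b - s) / s\<^sup>2"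
    using s by (simp add: field_simps power2_eq_square)
  also have "\<dots> < 0"
    using s \<open>a \<noteq> 0\<close> by (simp add: divide_neg_pos mult_pos_neg)
  finally show False by simp
qed

lemma inner_transpose_mult:
  fixes B :: "real ^ 'm ^ 'p"
  shows "(transpose B *v z) \<bullet> u = z \<bullet> (B *v u)"
  by (simp add: dot_lmul_matrix transpose_matrix_vector)

lemma inner_symmetric_mult:
  fixes M :: "real ^ 'n ^ 'n"
  assumes "transpose M = M"
  shows "(M *v u) \<bullet> v = u \<bullet> (M *v v)"
  using inner_transpose_mult[of M u v] assms by simp

text \<open>Eigenvectors chosen for distinct eigenvalues are orthogonal, hence independent, hence
  finite in number. Finiteness gives meaning to the \<open>Min\<close> in
  \<open>lambda_plus\<close>.\<close>

lemma finite_eigvals_symmetric: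
  fixes M :: "real ^ 'n ^ 'n"
  assumes sym: "transpose M = M"
  shows "finite (eigvals M)"
proof -
  define e where "e l = (SOME v. v \<noteq> 0 \<and> M *v v = l *\<^sub>R v)" for l
  have e: "e l \<noteq> 0 \<and> M *v e l = l *\<^sub>R e l" if "l \<in> eigvals M" for l
    unfolding e_def by (rule someI_ex) (use that in \<open>auto simp: eigvals_def\<close>)
  have inj: "inj_on e (eigvals M)"
  proof (rule inj_onI)
    fix k l assume "k \<in> eigvals M" "l \<in> eigvals M" "e k = e l"
    then have "k *\<^sub>R e k = l *\<^sub>R e k" "e k \<noteq> 0" using e by metis+
    then show "k = l" by simp
  qed
  have orth: "e k \<bullet> e l = 0" if "k \<in> eigvals M" "l \<in> eigvals M" "k \<noteq> l" for k l
  proof -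
    have "k * (e k \<bullet> e l) = l * (e k \<bullet> e l)"
      using inner_symmetric_mult[OF sym, of "e k" "e l"] e[OF that(1)] e[OF that(2)] by simp
    then show ?thesis using that(3) by simp
  qed
  have "independent (e ` eigvals M)"
    by (rule pairwise_orthogonal_independent)
      (use e orth in \<open>auto simp: pairwise_def orthogonal_def\<close>)
  then have "finite (e ` eigvals M)" by (rule independent_imp_finite)
  then show ?thesis using inj finite_imageD by blast
qed

text \<open>The Rayleigh quotient attains its minimum on the compact unit sphere, and a minimizer is
  an eigenvector.\<close>

lemma symmetric_min_eigval:
  fixes M :: "real ^ 'n ^ 'n"
  assumes sym: "transpose M = M"
  obtains l where "l \<in> eigvals M" "\<And>v. l * (norm v)\<^sup>2 \<le> v \<bullet> (M *v v)"
proof -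
  have "compact (sphere 0 1 :: (real ^ 'n) set)" by simp
  moreover have "sphere 0 1 \<noteq> ({} :: (real ^ 'n) set)" by simp
  moreover have "continuous_on (sphere 0 1) (\<lambda>v. v \<bullet> (M *v v))"
    by (intro continuous_intros linear_continuous_on bounded_linear_intros)
      (simp_all add: linear_linear matrix_vector_mul_linear)
  ultimately obtain v0 where v0: "norm v0 = 1"
    and min: "\<And>v. norm v = 1 \<Longrightarrow> v0 \<bullet> (M *v v0) \<le> v \<bullet> (M *v v)"
    using continuous_attains_inf[of "sphere 0 1" "\<lambda>v. v \<bullet> (M *v v)"] by auto
  define l where "l = v0 \<bullet> (M *v v0)"
  have bound: "l * (norm v)\<^sup>2 \<le> v \<bullet> (M *v v)" for v
  proof (cases "v = 0")
    case False
    have "l \<le> (inverse (norm v) *\<^sub>R v) \<bullet> (M *v (inverse (norm v) *\<^sub>R v))"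
      unfolding l_def by (rule min) (use False in simp)
    also have "\<dots> = v \<bullet> (M *v v) / (norm v)\<^sup>2"
      by (simp add: matrix_vector_mult_scaleR field_simps power2_eq_square)
    finally show ?thesis using False by (simp add: field_simps)
  qed simp
  \<comment> \<open>Perturbing the minimizer along its own defect \<open>w\<close> forces \<open>w = 0\<close>.\<close>
  define w where "w = M *v v0 - l *\<^sub>R v0"
  have "0 \<le> t * (2 * (norm w)\<^sup>2) + t\<^sup>2 * (w \<bullet> (M *v w) - l * (norm w)\<^sup>2)" for t
  proof -
    have "0 \<le> (v0 + t *\<^sub>R w) \<bullet> (M *v (v0 + t *\<^sub>R w)) - l * (norm (v0 + t *\<^sub>R w))\<^sup>2"
      using bound[of "v0 + t *\<^sub>R w"] by simp
    also have "\<dots> = (v0 \<bullet> (M *v v0) - l * (v0 \<bullet> v0)) + 2 * t * (w \<bullet> (M *v v0) - l * (w \<bullet> v0))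
        + t\<^sup>2 * (w \<bullet> (M *v w) - l * (norm w)\<^sup>2)"
      using inner_symmetric_mult[OF sym, of v0 w]
      unfolding power2_norm_eq_inner
      by (simp add: matrix_vector_right_distrib matrix_vector_mult_scaleR inner_add_left
          inner_add_right algebra_simps power2_eq_square inner_commute)
    also have "v0 \<bullet> v0 = 1" using v0 by (simp add: norm_eq_1)
    also have "w \<bullet> (M *v v0) - l * (w \<bullet> v0) = (norm w)\<^sup>2"
      by (simp add: power2_norm_eq_inner) (simp add: w_def inner_diff_right inner_diff_left algebra_simps)
    finally show ?thesis by (simp add: l_def algebra_simps)
  qed
  then have "2 * (norm w)\<^sup>2 = 0" by (rule quadratic_nonneg_imp_linear_zero)
  then have "M *v v0 = l *\<^sub>R v0" by (simp add: w_def)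
  then have "l \<in> eigvals M" using v0 by (auto simp: eigvals_def intro!: exI[of _ v0])
  then show thesis using bound that by blast
qed

text \<open>Injectivity makes the Gram matrix positive definite, so the eigenvalue \<open>l\<close>
  with the Rayleigh bound is positive and competes in the \<open>Min\<close> that defines
  \<open>lambda_plus\<close>.\<close>

lemma lambda_plus_gram:
  fixes B :: "real ^ 'm ^ 'p"
  assumes inj: "inj ((*v) B)"
  shows lambda_plus_gram_pos: "0 < lambda_plus (transpose B ** B)"
    and lambda_plus_gram_le: "lambda_plus (transpose B ** B) * (norm v)\<^sup>2 \<le> (norm (B *v v))\<^sup>2"
proof -
  let ?M = "transpose B ** B"
  have quad: "v \<bullet> (?M *v v) = (norm (B *v v))\<^sup>2" for v
    by (metis inner_commute inner_transpose_mult matrix_vector_mul_assoc power2_norm_eq_inner)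
  have sym: "transpose ?M = ?M" by (simp add: matrix_transpose_mul)
  obtain l where l: "l \<in> eigvals ?M" "\<And>v. l * (norm v)\<^sup>2 \<le> v \<bullet> (?M *v v)"
    using symmetric_min_eigval[OF sym] by blast
  have "0 < l"
  proof -
    obtain e where e: "e \<noteq> 0" "?M *v e = l *\<^sub>R e" using l(1) by (auto simp: eigvals_def)
    have "l * (norm e)\<^sup>2 = (norm (B *v e))\<^sup>2"
      using quad[of e] e(2) by (simp add: power2_norm_eq_inner)
    moreover have "B *v e \<noteq> 0"
      using inj e(1) by (metis injD matrix_vector_mult_0_right)
    ultimately have "l * (norm e)\<^sup>2 > 0" by simp
    then show ?thesis by (simp add: zero_less_mult_iff)
  qed
  with l(1) have mem: "l \<in> {l \<in> eigvals ?M. 0 < l}" by simp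
  have fin: "finite {l \<in> eigvals ?M. 0 < l}" using finite_eigvals_symmetric[OF sym] by simp
  have "lambda_plus ?M \<in> {l \<in> eigvals ?M. 0 < l}"
    unfolding lambda_plus_def by (rule Min_in) (use mem fin in auto)
  then show "0 < lambda_plus ?M" by simp
  have "lambda_plus ?M \<le> l" unfolding lambda_plus_def using fin mem by simp
  then have "lambda_plus ?M * (norm v)\<^sup>2 \<le> l * (norm v)\<^sup>2" by (rule mult_right_mono) simp
  also have "\<dots> \<le> (norm (B *v v))\<^sup>2" using l(2)[of v] quad by simp
  finally show "lambda_plus ?M * (norm v)\<^sup>2 \<le> (norm (B *v v))\<^sup>2" .
qed

text \<open>Cauchy-Schwarz for \<open>(transpose B *v (B *v u)) \<bullet> u\<close>, which equals
  \<open>(norm (B *v u))\<^sup>2\<close>. It will bound preimages under \<open>B\<close>.\<close>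

lemma lambda_plus_gram_norm_le:
  fixes B :: "real ^ 'm ^ 'p"
  assumes "inj ((*v) B)"
  shows "lambda_plus (transpose B ** B) * norm u \<le> norm (transpose B *v (B *v u))"
proof (cases "u = 0")
  case False
  have "lambda_plus (transpose B ** B) * norm u * norm u \<le> (transpose B *v (B *v u)) \<bullet> u"
    using lambda_plus_gram_le[OF assms, of u]
    unfolding inner_transpose_mult power2_norm_eq_inner[symmetric]
    by (simp add: power2_eq_square ac_simps)
  also have "\<dots> \<le> norm (transpose B *v (B *v u)) * norm u" by (rule norm_cauchy_schwarz)
  finally show ?thesis using False by simp
qed simp

text \<open>\<open>transpose B\<close> is bounded below on the range of \<open>B\<close>; this lets
  multiplier increments control residuals.\<close>

lemma lambda_plus_transpose_le:
  fixes B :: "real ^ 'm ^ 'p"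
  assumes "inj ((*v) B)"
  shows "lambda_plus (transpose B ** B) * (norm (B *v u))\<^sup>2 \<le> (norm (transpose B *v (B *v u)))\<^sup>2"
proof -
  let ?l = "lambda_plus (transpose B ** B)" and ?n = "norm (transpose B *v (B *v u))"
  have "(norm (B *v u))\<^sup>2 = (transpose B *v (B *v u)) \<bullet> u"
    unfolding inner_transpose_mult power2_norm_eq_inner ..
  also have "\<dots> \<le> ?n * norm u" by (rule norm_cauchy_schwarz)
  finally have "?l * (norm (B *v u))\<^sup>2 \<le> ?l * (?n * norm u)"
    using lambda_plus_gram_pos[OF assms] by simp
  also have "\<dots> = ?n * (?l * norm u)" by simp
  also have "\<dots> \<le> ?n * ?n"
    by (intro mult_left_mono lambda_plus_gram_norm_le assms) simp
  finally show ?thesis by (simp add: power2_eq_square)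
qed

subsection \<open>Gradients, semicontinuity and coercivity\<close>

text \<open>Riesz representation gives existence and uniqueness of derivatives gives uniqueness, so
  the \<open>THE\<close> in \<open>grad\<close> is well defined.\<close>

lemma GDERIV_grad:
  fixes g :: "'a::euclidean_space \<Rightarrow> real"
  assumes "g differentiable (at u)"
  shows "GDERIV g u :> grad g u"
proof -
  obtain g' where g': "(g has_derivative g') (at u)"
    using assms by (auto simp: differentiable_def)
  then have "linear g'" by (rule has_derivative_linear)
  have "g' = (\<lambda>v. v \<bullet> (\<Sum>b\<in>Basis. g' b *\<^sub>R b))"
  proof
    fix v
    have "g' v = g' (\<Sum>b\<in>Basis. (v \<bullet> b) *\<^sub>R b)" by (simp add: euclidean_representation)
    also have "\<dots> = (\<Sum>b\<in>Basis. (v \<bullet> b) * g' b)"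
      using \<open>linear g'\<close> by (simp add: linear_sum linear_scale)
    finally show "g' v = v \<bullet> (\<Sum>b\<in>Basis. g' b *\<^sub>R b)"
      by (simp add: inner_sum_right mult.commute)
  qed
  with g' have ex: "GDERIV g u :> (\<Sum>b\<in>Basis. g' b *\<^sub>R b)"
    by (simp add: gderiv_def)
  have uniq: "D = E" if "GDERIV g u :> D" "GDERIV g u :> E" for D E
  proof -
    have "(\<lambda>v. v \<bullet> D) = (\<lambda>v. v \<bullet> E)"
      using that unfolding gderiv_def by (rule has_derivative_unique)
    then have "v \<bullet> D = v \<bullet> E" for v by metis
    then show "D = E" by (metis inner_commute vector_eq_rdot)
  qed
  show ?thesis unfolding grad_def by (rule theI[of "\<lambda>D. GDERIV g u :> D", OF ex uniq[OF _ ex]])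
qed

lemma descent_lemma:
  fixes h :: "'a::euclidean_space \<Rightarrow> real"
  assumes diff: "\<And>v. h differentiable (at v)" and lip: "L-lipschitz_on UNIV (grad h)"
  shows "h (v + d) \<le> h v + grad h v \<bullet> d + L / 2 * (norm d)\<^sup>2"
proof -
  \<comment> \<open>\<open>\<phi>\<close> is \<open>h\<close> along the segment minus the claimed
    quadratic model; the Lipschitz bound makes its derivative nonpositive on [0, 1].\<close>
  define \<phi> where "\<phi> t = h (v + t *\<^sub>R d) - t * (grad h v \<bullet> d) - L / 2 * t\<^sup>2 * (norm d)\<^sup>2" for t
  have "\<phi> 1 \<le> \<phi> 0"
  proof (rule DERIV_nonpos_imp_nonincreasing[of 0 1 \<phi>])
    fix t :: real assume t: "0 \<le> t" "t \<le> 1"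
    have "(h has_derivative (\<lambda>w. w \<bullet> grad h (v + t *\<^sub>R d))) (at (v + t *\<^sub>R d))"
      using GDERIV_grad[OF diff] by (simp add: gderiv_def)
    then have "((\<lambda>t. h (v + t *\<^sub>R d)) has_derivative (\<lambda>s. (s *\<^sub>R d) \<bullet> grad h (v + t *\<^sub>R d))) (at t)"
      by (rule has_derivative_compose[rotated]) (auto intro!: derivative_eq_intros)
    then have "((\<lambda>t. h (v + t *\<^sub>R d)) has_real_derivative d \<bullet> grad h (v + t *\<^sub>R d)) (at t)"
      by (simp add: has_field_derivative_def mult.commute[of _ "d \<bullet> _"] mult_commute_abs)
    then have "(\<phi> has_real_derivative
        d \<bullet> grad h (v + t *\<^sub>R d) - grad h v \<bullet> d - L * t * (norm d)\<^sup>2) (at t)"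
      unfolding \<phi>_def by (auto intro!: derivative_eq_intros)
    moreover have "d \<bullet> grad h (v + t *\<^sub>R d) - grad h v \<bullet> d - L * t * (norm d)\<^sup>2 \<le> 0"
    proof -
      have "d \<bullet> grad h (v + t *\<^sub>R d) - grad h v \<bullet> d = (grad h (v + t *\<^sub>R d) - grad h v) \<bullet> d"
        by (simp add: inner_diff_left inner_commute[of d])
      also have "\<dots> \<le> norm (grad h (v + t *\<^sub>R d) - grad h v) * norm d" by (rule norm_cauchy_schwarz)
      also have "\<dots> \<le> (L * norm (t *\<^sub>R d)) * norm d"
        using lipschitz_onD[OF lip, of "v + t *\<^sub>R d" v]
        by (intro mult_right_mono) (auto simp: dist_norm)
      finally show ?thesis using t by (simp add: power2_eq_square algebra_simps)
    qed
    ultimately show "\<exists>y. (\<phi> has_real_derivative y) (at t) \<and> y \<le> 0" by blast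
  qed simp
  then show ?thesis by (simp add: \<phi>_def)
qed

text \<open>A gradient step of length 1/\<open>K\<close> lowers \<open>h\<close> by at least
  |grad|^2/(2\<open>K\<close>), yet cannot pass below \<open>m\<close>. Allowing \<open>K\<close>
  above \<open>L\<close> covers \<open>L = 0\<close> and later permits
  \<open>K = a / 2\<close>.\<close>

lemma norm_grad_sq_le:
  fixes h :: "'a::euclidean_space \<Rightarrow> real"
  assumes diff: "\<And>v. h differentiable (at v)" and lip: "L-lipschitz_on UNIV (grad h)"
    and K: "L \<le> K" "0 < K" and m: "\<And>v. m \<le> h v"
  shows "(norm (grad h v))\<^sup>2 \<le> 2 * K * (h v - m)"
proof -
  let ?G = "grad h v"
  have lipK: "K-lipschitz_on UNIV (grad h)" using lip K(1) by (rule lipschitz_on_le)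
  have "m \<le> h (v + (- 1 / K) *\<^sub>R ?G)" by (rule m)
  also have "\<dots> \<le> h v + ?G \<bullet> ((- 1 / K) *\<^sub>R ?G) + K / 2 * (norm ((- 1 / K) *\<^sub>R ?G))\<^sup>2"
    by (rule descent_lemma[OF diff lipK])
  also have "\<dots> = h v - (norm ?G)\<^sup>2 / (2 * K)"
    using K(2) by (simp add: power2_norm_eq_inner[symmetric] power_mult_distrib power_divide)
      (simp add: field_simps power2_eq_square)
  finally show ?thesis using K(2) by (simp add: field_simps)
qed

text \<open>Coercivity makes \<open>f\<close> positive outside a ball; on the ball, compactness
  leaves finitely many of the local lower bounds given by semicontinuity.\<close>

lemma lsc_coercive_bounded_below:
  fixes f :: "'a::euclidean_space \<Rightarrow> ereal"
  assumes lsc: "lsc f" and coer: "coercive f" and f: "\<And>x. f x \<noteq> -\<infinity>"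
  obtains m :: real where "\<And>x. ereal m \<le> f x"
proof -
  have "eventually (\<lambda>x. 0 < f x) at_infinity"
    using coer unfolding coercive_def by (rule order_tendstoD) simp
  then obtain b where b: "\<And>x. b \<le> norm x \<Longrightarrow> 0 < f x"
    by (auto simp: eventually_at_infinity)
  have "\<exists>U m. open U \<and> x \<in> U \<and> (\<forall>u\<in>U. ereal m < f u)" for x
  proof -
    obtain m :: real where m: "ereal m < f x"
      using f[of x] ereal_dense2[of "-\<infinity>" "f x"] by auto
    also have "f x \<le> Liminf (at x) f" using lsc by (simp add: lsc_def)
    finally have "eventually (\<lambda>u. ereal m < f u) (at x)" by (rule less_LiminfD)
    \<comment> \<open>The filter \<open>at x\<close> omits \<open>x\<close> itself; the choice of
      \<open>m\<close> covers that point.\<close>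
    with m have "eventually (\<lambda>u. ereal m < f u) (nhds x)"
      by (auto simp: eventually_nhds_conv_at)
    then show ?thesis by (metis eventually_nhds)
  qed
  then obtain U :: "'a \<Rightarrow> 'a set" and m :: "'a \<Rightarrow> real"
    where U: "\<And>x. open (U x)" "\<And>x. x \<in> U x" "\<And>x u. u \<in> U x \<Longrightarrow> ereal (m x) < f u"
    by metis
  obtain C where C: "finite C" "cball 0 b \<subseteq> (\<Union>x\<in>C. U x)"
  proof (rule compactE_image[of "cball 0 b" "cball 0 b" U])
    show "cball 0 b \<subseteq> (\<Union>x\<in>cball 0 b. U x)" using U(2) by blast
  qed (use U in auto)
  \<comment> \<open>The inserted 0 serves the points outside the ball and keeps the set
    nonempty.\<close>
  define M where "M = Min (insert 0 (m ` C))"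
  have "ereal M \<le> f x" for x
  proof (cases "b \<le> norm x")
    case True
    have "M \<le> 0" using C(1) by (simp add: M_def)
    then show ?thesis using b[OF True] by (metis ereal_less_eq(3) less_imp_le order_trans zero_ereal_def)
  next
    case False
    then have "x \<in> cball 0 b" by simp
    then obtain c where c: "c \<in> C" "x \<in> U c" using C(2) by blast
    have "M \<le> m c" using C(1) c(1) by (simp add: M_def)
    then show ?thesis using U(3)[OF c(2)] by (metis ereal_less_eq(3) less_imp_le order_trans)
  qed
  then show thesis by (rule that)
qed

lemma lsc_continuous:
  fixes g :: "'a::euclidean_space \<Rightarrow> real"
  assumes "\<And>u. isCont g u"
  shows "lsc (\<lambda>u. ereal (g u))"
proof -
  have "((\<lambda>u. ereal (g u)) \<longlongrightarrow> ereal (g x)) (at x)" for x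
    using assms[of x] by (simp add: isCont_def)
  then have "Liminf (at x) (\<lambda>u. ereal (g u)) = ereal (g x)" for x
    by (intro lim_imp_Liminf) auto
  then show ?thesis by (simp add: lsc_def)
qed

lemma coercive_sublevel_bounded:
  assumes "coercive (\<lambda>u. ereal (g u))"
  shows "bounded {u. g u \<le> C}"
proof -
  have "eventually (\<lambda>u. ereal C < ereal (g u)) at_infinity"
    using assms unfolding coercive_def by (rule order_tendstoD) simp
  then obtain b where "\<And>u. b \<le> norm u \<Longrightarrow> C < g u"
    by (auto simp: eventually_at_infinity)
  then have "{u. g u \<le> C} \<subseteq> cball 0 b"
    by (force simp: not_less[symmetric])
  then show ?thesis using bounded_cball bounded_subset by blast
qed

lemma bounded_range_tail:
  fixes s :: "nat \<Rightarrow> 'a::metric_space"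
  assumes "bounded (s ` {N..})"
  shows "bounded (range s)"
proof -
  have "range s = s ` {..<N} \<union> s ` {N..}" by (auto simp flip: image_Un)
  then show ?thesis using assms by (simp add: finite_imp_bounded)
qed

lemma argmin_le: "u \<in> argmin F \<Longrightarrow> F u \<le> F v"
  by (auto simp: argmin_def is_arg_min_def not_less)

subsection \<open>Boundedness of the iterates\<close>

text \<open>The objective is quadratic, so moving from \<open>v1\<close> along its own gradient
  \<open>?G\<close> by t changes it by exactly t |\<open>?G\<close>|^2 plus a multiple of t^2;
  minimality then forces \<open>?G\<close> to vanish.\<close>

lemma argmin_proximal_stationary:
  assumes sym: "transpose Q = Q"
    and v1: "v1 \<in> argmin (\<lambda>v. p \<bullet> (v - v0) + \<alpha> / 2 * (norm (residual A B c w v))\<^sup>2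
              + 1 / 2 * sqnorm_mat Q (v - v0))"
  shows "p + \<alpha> *\<^sub>R (transpose B *v residual A B c w v1) + Q *v (v1 - v0) = 0"
    (is "?G = 0")
proof -
  define F where "F v = p \<bullet> (v - v0) + \<alpha> / 2 * (norm (residual A B c w v))\<^sup>2
    + 1 / 2 * sqnorm_mat Q (v - v0)" for v
  have "0 \<le> t * (?G \<bullet> ?G) + t\<^sup>2 * (\<alpha> / 2 * (norm (B *v ?G))\<^sup>2 + 1 / 2 * (?G \<bullet> (Q *v ?G)))" for t
  proof -
    define d where "d = ?G"
    define e where "e = v1 - v0"
    define \<rho> where "\<rho> = residual A B c w v1"
    have G: "d \<bullet> d = p \<bullet> d + \<alpha> * (\<rho> \<bullet> (B *v d)) + e \<bullet> (Q *v d)"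
      by (subst (1) d_def) (simp only: inner_add_left inner_scaleR_left inner_transpose_mult
          inner_symmetric_mult[OF sym] \<rho>_def e_def)
    have res: "residual A B c w (v1 + t *\<^sub>R d) = \<rho> + t *\<^sub>R (B *v d)"
      by (simp add: residual_def \<rho>_def matrix_vector_right_distrib matrix_vector_mult_scaleR)
    have shift: "v1 + t *\<^sub>R d - v0 = e + t *\<^sub>R d" by (simp add: e_def)
    have "0 \<le> F (v1 + t *\<^sub>R d) - F v1"
      using argmin_le[OF v1, of "v1 + t *\<^sub>R d"] by (simp add: F_def)
    also have "F (v1 + t *\<^sub>R d) = p \<bullet> (e + t *\<^sub>R d) + \<alpha> / 2 * (norm (\<rho> + t *\<^sub>R (B *v d)))\<^sup>2
      + 1 / 2 * ((e + t *\<^sub>R d) \<bullet> (Q *v (e + t *\<^sub>R d)))"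
      by (simp only: F_def res shift sqnorm_mat_def)
    also have "F v1 = p \<bullet> e + \<alpha> / 2 * (norm \<rho>)\<^sup>2 + 1 / 2 * (e \<bullet> (Q *v e))"
      by (simp only: F_def sqnorm_mat_def e_def \<rho>_def)
    also have "p \<bullet> (e + t *\<^sub>R d) + \<alpha> / 2 * (norm (\<rho> + t *\<^sub>R (B *v d)))\<^sup>2
        + 1 / 2 * ((e + t *\<^sub>R d) \<bullet> (Q *v (e + t *\<^sub>R d)))
        - (p \<bullet> e + \<alpha> / 2 * (norm \<rho>)\<^sup>2 + 1 / 2 * (e \<bullet> (Q *v e)))
      = t * (d \<bullet> d) + t\<^sup>2 * (\<alpha> / 2 * (norm (B *v d))\<^sup>2 + 1 / 2 * (d \<bullet> (Q *v d)))"
      using inner_symmetric_mult[OF sym, of e d]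
      unfolding power2_norm_eq_inner G
      by (simp add: matrix_vector_right_distrib matrix_vector_mult_scaleR inner_add_left
          inner_add_right power2_eq_square inner_commute field_simps)
    finally show ?thesis by (simp only: d_def)
  qed
  then have "?G \<bullet> ?G = 0" by (rule quadratic_nonneg_imp_linear_zero)
  then show ?thesis by simp
qed

lemma norm_mult_le_Sup_mat_norm:
  assumes "bdd_above (range (\<lambda>k. mat_norm (Q k)))"
  shows "norm (Q k *v v) \<le> (SUP k. mat_norm (Q k)) * norm v"
proof -
  have "norm (Q k *v v) \<le> mat_norm (Q k) * norm v"
    unfolding mat_norm_def by (rule onorm) (rule matrix_vector_mul_bounded_linear)
  also have "\<dots> \<le> (SUP k. mat_norm (Q k)) * norm v"
    by (intro mult_right_mono cSUP_upper assms) auto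
  finally show ?thesis .
qed

lemma mat_norm_nonneg: "0 \<le> mat_norm M"
  unfolding mat_norm_def by (rule onorm_pos_le) (rule matrix_vector_mul_bounded_linear)

text \<open>\<open>1 - \<bar>1 - \<beta>\<bar>\<close> is the minimum of \<beta> and 2 - \<beta>, a
  number in (0, 1], so squaring does not increase it.\<close>

lemma relaxation_square_le:
  fixes \<beta> :: real
  assumes "0 < \<beta>" "\<beta> < 2"
  shows "0 < 1 - \<bar>1 - \<beta>\<bar>" "1 - \<bar>1 - \<beta>\<bar> \<le> \<beta>" "(1 - \<bar>1 - \<beta>\<bar>)\<^sup>2 \<le> \<beta>"
proof -
  show d: "0 < 1 - \<bar>1 - \<beta>\<bar>" "1 - \<bar>1 - \<beta>\<bar> \<le> \<beta>" using assms by auto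
  have "(1 - \<bar>1 - \<beta>\<bar>)\<^sup>2 \<le> 1 - \<bar>1 - \<beta>\<bar>"
    unfolding power2_eq_square using d by (intro mult_left_le) auto
  with d show "(1 - \<bar>1 - \<beta>\<bar>)\<^sup>2 \<le> \<beta>" by linarith
qed

text \<open>Serves \<open>theta0\<close> with \<open>s = Lh + q2\<close> and \<open>theta1\<close>
  with \<open>s = q2\<close>.\<close>

lemma theta_weight_ge:
  fixes a \<beta> s :: real
  assumes "0 < a" "0 < \<beta>" "\<beta> < 2"
  shows "2 * s\<^sup>2 / a \<le> 2 * \<beta> * s\<^sup>2 / (a * (1 - \<bar>1 - \<beta>\<bar>)\<^sup>2)"
proof -
  note d = relaxation_square_le[OF assms(2,3)]
  have "(1 - \<bar>1 - \<beta>\<bar>)\<^sup>2 * (2 * s\<^sup>2) \<le> \<beta> * (2 * s\<^sup>2)" using d by (intro mult_right_mono) auto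
  then show ?thesis using d assms by (simp add: field_simps)
qed

text \<open>If \<open>a < 2 * L\<close>, then the right side of \<open>le\<close> is too small to
  accommodate 2 (\<open>L\<close> + \<open>q\<close>)^2 / \<open>a\<close>.\<close>

lemma step_parameter_ge:
  fixes a L q :: real
  assumes "0 < a" "0 \<le> L" "0 \<le> q" and le: "L + 2 * (L + q)\<^sup>2 / a \<le> q + a"
  shows "2 * L \<le> a"
proof (rule ccontr)
  assume "\<not> 2 * L \<le> a"
  then have a: "a < 2 * L" by simp
  have "2 * (L + q)\<^sup>2 \<le> (q + a - L) * a" using le assms(1) by (simp add: field_simps)
  also have "\<dots> < (q + L) * (2 * L)"
  proof (rule le_less_trans)
    show "(q + a - L) * a \<le> (q + L) * a" using a assms by (intro mult_right_mono) auto
    show "(q + L) * a < (q + L) * (2 * L)" using a assms by (intro mult_strict_left_mono) auto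
  qed
  also have "\<dots> \<le> 2 * (L + q)\<^sup>2"
    using assms by (simp add: power2_eq_square algebra_simps)
  finally show False by simp
qed

text \<open>Two completed squares: the \<open>G\<close> term uses \<open>a / 4\<close> and the
  \<open>D\<close> term \<open>a / 8\<close> of the budget \<open>a / 2\<close> in front of
  \<open>n\<^sup>2\<close>, so \<open>a / 8\<close> remains; \<open>\<eta> - m\<close> pays for
  \<open>G\<^sup>2 / a\<close>.\<close>

lemma young_lower_bound:
  fixes a G D n s m \<eta> :: real
  assumes a: "0 < a" and G: "G\<^sup>2 \<le> a * (\<eta> - m)"
  shows "m + a / 8 * n\<^sup>2 \<le> \<eta> - G * n - s * D * n + a / 2 * n\<^sup>2 + 2 * s\<^sup>2 / a * D\<^sup>2"
proof -
  have "0 \<le> (G - a / 2 * n)\<^sup>2 / a" "0 \<le> 2 * (s * D - a / 4 * n)\<^sup>2 / a" using a by auto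
  moreover have "(G - a / 2 * n)\<^sup>2 / a = G\<^sup>2 / a - G * n + a / 4 * n\<^sup>2"
    using a by (simp add: field_simps power2_eq_square)
  moreover have "2 * (s * D - a / 4 * n)\<^sup>2 / a = 2 * s\<^sup>2 / a * D\<^sup>2 - s * D * n + a / 8 * n\<^sup>2"
    using a by (simp add: field_simps power2_eq_square)
  moreover have "G\<^sup>2 / a \<le> \<eta> - m" using a G by (simp add: field_simps)
  ultimately show ?thesis by (simp add: algebra_simps)
qed

theorem theorem1:
  fixes A :: "real ^ 'n ^ 'p" and B :: "real ^ 'm ^ 'p" and c :: "real ^ 'p"
    and f :: "real ^ 'n \<Rightarrow> ereal" and g :: "real ^ 'n \<Rightarrow> real" and h :: "real ^ 'm \<Rightarrow> real"
    and \<alpha> \<beta> r \<sigma> Lg Lh q1 q2 :: real and k0 :: nat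
    and Q1 :: "nat \<Rightarrow> real ^ 'n ^ 'n" and Q2 :: "nat \<Rightarrow> real ^ 'm ^ 'm"
    and x :: "nat \<Rightarrow> real ^ 'n" and y :: "nat \<Rightarrow> real ^ 'm" and z :: "nat \<Rightarrow> real ^ 'p"
    and R :: "nat \<Rightarrow> ereal"
  assumes f_proper: "proper f"
    and g_diff: "\<And>u. g differentiable (at u)"
    and h_diff: "\<And>v. h differentiable (at v)"
    and Q_psd: "\<And>k. sym_psd (Q1 k)" "\<And>k. sym_psd (Q2 k)"
    and A1: "lsc f" "coercive f"
    and A2: "coercive (\<lambda>u. ereal (g u))" "bdd_below (range h)"
    and A3: "rank B = CARD('m)" "range ((*v) A) \<subseteq> range ((*v) B)" "c \<in> range ((*v) B)"
    and A4: "Lg-lipschitz_on UNIV (grad g)" "Lh-lipschitz_on UNIV (grad h)"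
    and A5: "\<alpha> > 0" "0 < \<beta>" "\<beta> < 2"
        "(INF k. mat_norm (Q1 k)) \<ge> 0" "(INF k. mat_norm (Q2 k)) \<ge> 0"
        "bdd_above (range (\<lambda>k. mat_norm (Q1 k)))" "bdd_above (range (\<lambda>k. mat_norm (Q2 k)))"
    and q1_def: "q1 = (SUP k. mat_norm (Q1 k))"
    and q2_def: "q2 = (SUP k. mat_norm (Q2 k))"
    and admm: "pl_admm A B c f g h \<alpha> \<beta> Q1 Q2 x y z"
    and R_def: "\<And>k. k \<ge> 1 \<Longrightarrow>
        R k = regularized_lagrangian A B c f g h \<alpha> \<beta> r Lh q2 (x k) (y k) (z k) (y (k - 1)) (z (k - 1))"
    and r: "r > 1" and k0: "k0 \<ge> 1" and \<sigma>: "\<sigma> > 0"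
    and params: "Inf (\<Union>k\<in>{k0..}.
        {mat_norm (Q1 k) - \<alpha> * lambda_max (transpose A ** A) - Lg,
         mat_norm (Q2 k) + \<alpha> * lambda_plus (transpose B ** B)
           - (Lh + r * theta0 B \<alpha> \<beta> Lh q2 + r * theta1 B \<alpha> \<beta> q2),
         (r - 1) / (\<alpha> * \<beta>)}) > \<sigma>"
    and descent: "\<And>k. k \<ge> k0 \<Longrightarrow>
        R (Suc k) + ereal (\<sigma> * ((norm (x (Suc k) - x k))\<^sup>2 + (norm (y (Suc k) - y k))\<^sup>2
                                + (norm (z (Suc k) - z k))\<^sup>2)) \<le> R k \<and> R k \<le> R k0"
  shows "bounded (range (\<lambda>k. (x k, y k, z k)))"
proof -

  \<comment> \<open>Constants and their signs\<close>
  define l where "l = lambda_plus (transpose B ** B)"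
  define a where "a = \<alpha> * l"
  have injB: "inj ((*v) B)" using A3(1) full_rank_injective by blast
  have l: "0 < l" "\<And>v. l * (norm v)\<^sup>2 \<le> (norm (B *v v))\<^sup>2"
    using lambda_plus_gram[OF injB] by (simp_all add: l_def)
  have a: "0 < a" using l A5(1) by (simp add: a_def)
  have Lh: "0 \<le> Lh" using A4(2) by (rule lipschitz_on_nonneg)
  have q2: "mat_norm (Q2 k) \<le> q2" for k
    unfolding q2_def by (rule cSUP_upper) (use A5 in auto)
  have q2_nonneg: "0 \<le> q2" using q2[of 0] mat_norm_nonneg[of "Q2 0"] by linarith
  define \<theta>0 \<theta>1 \<gamma>0 where "\<theta>0 = theta0 B \<alpha> \<beta> Lh q2" "\<theta>1 = theta1 B \<alpha> \<beta> q2" "\<gamma>0 = gamma0 B \<alpha> \<beta>"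
  have \<theta>0: "2 * (Lh + q2)\<^sup>2 / a \<le> \<theta>0" and \<theta>1: "0 \<le> \<theta>1"
    using theta_weight_ge[OF a A5(2,3), of "Lh + q2"] theta_weight_ge[OF a A5(2,3), of q2] a
    by (auto simp: \<theta>0_\<theta>1_\<gamma>0_def theta0_def theta1_def a_def l_def intro: order_trans[rotated])
  have \<theta>0_nonneg: "0 \<le> \<theta>0" using \<theta>0 a by (auto intro: order_trans[rotated])

  \<comment> \<open>Consequence of the parameter condition\<close>
  have aL: "2 * Lh \<le> a"
  proof (rule step_parameter_ge[OF a Lh q2_nonneg])
    let ?S = "\<Union>k\<in>{k0..}. {mat_norm (Q1 k) - \<alpha> * lambda_max (transpose A ** A) - Lg,
         mat_norm (Q2 k) + \<alpha> * lambda_plus (transpose B ** B)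
           - (Lh + r * theta0 B \<alpha> \<beta> Lh q2 + r * theta1 B \<alpha> \<beta> q2), (r - 1) / (\<alpha> * \<beta>)}"
    \<comment> \<open>Dropping the nonnegative norms of \<open>Q1 k\<close> and \<open>Q2 k\<close>
      leaves a bound independent of \<open>k\<close>.\<close>
    let ?b = "min (- \<alpha> * lambda_max (transpose A ** A) - Lg)
        (min (a - (Lh + r * \<theta>0 + r * \<theta>1)) ((r - 1) / (\<alpha> * \<beta>)))"
    \<comment> \<open>\<open>Inf\<close> of a set of reals that is unbounded below is unspecified.\<close>
    have "bdd_below ?S"
    proof (rule bdd_belowI[of _ ?b])
      fix s assume "s \<in> ?S"
      then obtain k where "s \<in> {mat_norm (Q1 k) - \<alpha> * lambda_max (transpose A ** A) - Lg,
         mat_norm (Q2 k) + \<alpha> * lambda_plus (transpose B ** B)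
           - (Lh + r * theta0 B \<alpha> \<beta> Lh q2 + r * theta1 B \<alpha> \<beta> q2), (r - 1) / (\<alpha> * \<beta>)}" by blast
      then show "?b \<le> s"
        using mat_norm_nonneg[of "Q1 k"] mat_norm_nonneg[of "Q2 k"]
        by (auto simp: a_def l_def \<theta>0_\<theta>1_\<gamma>0_def min_def)
    qed
    \<comment> \<open>The middle entry at \<open>k0\<close>, with its norm bounded by
      \<open>q2\<close>, yields the premise of \<open>step_parameter_ge\<close>.\<close>
    then have "Inf ?S \<le> mat_norm (Q2 k0) + a - (Lh + r * \<theta>0 + r * \<theta>1)"
      by (rule cInf_lower[rotated]) (auto simp: a_def l_def \<theta>0_\<theta>1_\<gamma>0_def)
    with params \<sigma> q2[of k0] have "Lh + r * \<theta>0 + r * \<theta>1 \<le> q2 + a" by linarith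
    moreover have "1 * \<theta>0 \<le> r * \<theta>0" "0 \<le> r * \<theta>1"
      using r \<theta>0_nonneg \<theta>1 by (intro mult_right_mono mult_nonneg_nonneg; simp)+
    ultimately show "Lh + 2 * (Lh + q2)\<^sup>2 / a \<le> q2 + a" using \<theta>0 by linarith
  qed

  \<comment> \<open>Lower bounds of the objective terms\<close>
  obtain mh where mh: "\<And>v. mh \<le> h v" using A2(2) by (auto simp: bdd_below_def)
  have grad_h: "(norm (grad h v))\<^sup>2 \<le> a * (h v - mh)" for v
    using norm_grad_sq_le[OF h_diff A4(2), of "a / 2" mh v] aL a mh by simp
  have f_ninf: "f u \<noteq> -\<infinity>" for u using f_proper by (simp add: proper_def)
  obtain mf where mf: "\<And>u. ereal mf \<le> f u"
    using lsc_coercive_bounded_below[OF A1 f_ninf] by blast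
  have "isCont g u" for u using g_diff by (rule differentiable_imp_continuous_within)
  then obtain mg where mg: "\<And>u. mg \<le> g u"
    using lsc_coercive_bounded_below[OF lsc_continuous A2(1)] by auto

  \<comment> \<open>Residuals, multipliers and optimality of the y-step\<close>
  define \<rho> where "\<rho> k = residual A B c (x k) (y k)" for k
  have z_step: "z (Suc k) = z k + (\<alpha> * \<beta>) *\<^sub>R \<rho> (Suc k)" for k
    using admm by (simp add: pl_admm_def \<rho>_def)
  have y_opt: "grad h (y k) + transpose B *v z k + \<alpha> *\<^sub>R (transpose B *v \<rho> (Suc k))
      + Q2 k *v (y (Suc k) - y k) = 0" for k
    unfolding \<rho>_def
  proof (rule argmin_proximal_stationary)
    show "transpose (Q2 k) = Q2 k" using Q_psd(2) by (simp add: sym_psd_def)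
  qed (use admm in \<open>auto simp: pl_admm_def\<close>)
  \<comment> \<open>The y-step involves the old multiplier; inserting the multiplier update changes
    the coefficient \<alpha> into \<alpha> (1 - \<beta>).\<close>
  have BT_z: "transpose B *v z (Suc k) = - grad h (y k) - Q2 k *v (y (Suc k) - y k)
      - (\<alpha> * (1 - \<beta>)) *\<^sub>R (transpose B *v \<rho> (Suc k))" for k
  proof -
    have "transpose B *v z (Suc k) = transpose B *v z k + (\<alpha> * \<beta>) *\<^sub>R (transpose B *v \<rho> (Suc k))"
      unfolding z_step by (simp only: matrix_vector_right_distrib matrix_vector_mult_scaleR)
    also have "transpose B *v z k = - grad h (y k) - \<alpha> *\<^sub>R (transpose B *v \<rho> (Suc k))
        - Q2 k *v (y (Suc k) - y k)"
      using y_opt[of k] by (simp add: algebra_simps eq_neg_iff_add_eq_0)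
    finally show ?thesis by (simp add: algebra_simps)
  qed
  have sub: "subspace (range ((*v) B))"
    by (intro linear_subspace_image) (auto simp: matrix_vector_mul_linear)
  have \<rho>_range: "\<rho> k \<in> range ((*v) B)" for k
    unfolding \<rho>_def residual_def using A3(2,3) by (intro subspace_add sub) auto
  then have "\<exists>u. B *v u = \<rho> k" for k by (metis imageE)
  then obtain u where u: "\<And>k. B *v u k = \<rho> k" by metis
  \<comment> \<open>\<open>z 0\<close> is arbitrary, so only the displacement from it has a preimage
    under \<open>B\<close>.\<close>
  have z_range: "z k - z 0 \<in> range ((*v) B)" for k
  proof (induction k)
    case 0
    then show ?case using subspace_0[OF sub] by simp
  next
    case (Suc k)
    have "z (Suc k) - z 0 = (z k - z 0) + (\<alpha> * \<beta>) *\<^sub>R \<rho> (Suc k)" by (simp add: z_step)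
    then show ?case using Suc \<rho>_range by (simp only: subspace_add subspace_scale sub)
  qed
  then have "\<exists>s. B *v s = z k - z 0" for k by (metis imageE)
  then obtain s where s: "\<And>k. B *v s k = z k - z 0" by metis

  \<comment> \<open>Compare the minimizer with a point \<open>w\<close> of the domain of
    \<open>f\<close>. The index starts at 1 because \<open>f (x 0)\<close> may be infinite.\<close>
  have f_fin: "f (x (Suc k)) < \<infinity>" for k
  proof -
    obtain w where w: "f w \<noteq> \<infinity>" using f_proper by (auto simp: proper_def)
    obtain t t' :: real where "f (x (Suc k)) + ereal t \<le> f w + ereal t'"
      using admm[unfolded pl_admm_def, rule_format, of k, THEN conjunct1, THEN argmin_le, of w]
      by blast
    then show ?thesis using w by (cases "f w"; cases "f (x (Suc k))") auto
  qed
  define F where "F k = real_of_ereal (f (x k))" for k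
  have F: "f (x k) = ereal (F k)" if "1 \<le> k" for k
    unfolding F_def using f_fin[of "k - 1"] f_ninf[of "x k"] that
    by (cases "f (x k)") auto

  \<comment> \<open>The part of the regularized Lagrangian other than \<open>f\<close> and
    \<open>g\<close>; separating it allows real arithmetic from index 1 on.\<close>
  define \<Phi> where "\<Phi> k = h (y k) + z k \<bullet> \<rho> k + \<alpha> / 2 * (norm (\<rho> k))\<^sup>2
     + (r * \<gamma>0 * (norm (transpose B *v (z k - z (k - 1))))\<^sup>2 + r * \<theta>0 * (norm (y k - y (k - 1)))\<^sup>2)" for k
  have R: "R k = ereal (F k + g (x k) + \<Phi> k)" if "1 \<le> k" for k
    unfolding R_def[OF that] regularized_lagrangian_def aug_lagrangian_def F[OF that]
    by (simp add: \<Phi>_def \<rho>_def \<theta>0_\<theta>1_\<gamma>0_def)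
  have upper: "F k + g (x k) + \<Phi> k \<le> F k0 + g (x k0) + \<Phi> k0" if "k0 \<le> k" for k
    using descent[OF that] R[of k] R[OF k0] that k0 by simp

  \<comment> \<open>Lower bound of the regularized Lagrangian\<close>
  have lower: "mh + a / 8 * (norm (u k))\<^sup>2 \<le> \<Phi> k" if k1: "1 \<le> k" for k
  proof -
    obtain j where k: "k = Suc j" using k1 by (cases k) auto
    define dy where "dy = y k - y j"
    have zk: "transpose B *v z k
        = - grad h (y j) - Q2 j *v dy - (\<alpha> * (1 - \<beta>)) *\<^sub>R (transpose B *v \<rho> k)"
      using BT_z[of j] by (simp only: k dy_def)
    have "z k \<bullet> \<rho> k = (transpose B *v z k) \<bullet> u k" by (simp only: inner_transpose_mult u)
    also have "\<dots> = - (grad h (y j) \<bullet> u k) - (Q2 j *v dy) \<bullet> u k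
        - \<alpha> * (1 - \<beta>) * ((transpose B *v \<rho> k) \<bullet> u k)"
      unfolding zk by (simp only: inner_diff_left inner_minus_left inner_scaleR_left)
    also have "(transpose B *v \<rho> k) \<bullet> u k = (norm (\<rho> k))\<^sup>2"
      by (simp only: inner_transpose_mult u power2_norm_eq_inner)
    finally have zr: "z k \<bullet> \<rho> k = - (grad h (y j) \<bullet> u k) - (Q2 j *v dy) \<bullet> u k
        - \<alpha> * (1 - \<beta>) * (norm (\<rho> k))\<^sup>2" .
    have Q: "(Q2 j *v dy) \<bullet> u k \<le> q2 * norm dy * norm (u k)"
    proof -
      have "(Q2 j *v dy) \<bullet> u k \<le> norm (Q2 j *v dy) * norm (u k)" by (rule norm_cauchy_schwarz)
      also have "\<dots> \<le> q2 * norm dy * norm (u k)"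
        unfolding q2_def by (intro mult_right_mono norm_mult_le_Sup_mat_norm A5) auto
      finally show ?thesis .
    qed
    \<comment> \<open>\<open>BT_z\<close> has the gradient at the previous iterate,
      \<open>grad_h\<close> is applied at the current one. The change costs
      \<open>Lh * norm dy\<close>, whence the sum \<open>Lh + q2\<close> in
      \<open>theta0\<close>.\<close>
    have G: "grad h (y j) \<bullet> u k \<le> norm (grad h (y k)) * norm (u k) + Lh * norm dy * norm (u k)"
    proof -
      have "grad h (y j) \<bullet> u k \<le> norm (grad h (y j)) * norm (u k)" by (rule norm_cauchy_schwarz)
      also have "norm (grad h (y j)) \<le> norm (grad h (y k)) + Lh * norm dy"
        using lipschitz_onD[OF A4(2), of "y j" "y k"]
          norm_triangle_ineq2[of "grad h (y j)" "grad h (y k)"]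
        by (simp add: dist_norm dy_def norm_minus_commute)
      finally show ?thesis by (simp add: distrib_right mult_right_mono)
    qed
    have zd: "transpose B *v (z k - z j) = (\<alpha> * \<beta>) *\<^sub>R (transpose B *v (B *v u k))"
      unfolding k z_step u by (simp only: add_diff_cancel_left' matrix_vector_mult_scaleR)
    note \<delta> = relaxation_square_le[OF A5(2,3)]
    have \<gamma>0_nonneg: "0 \<le> \<gamma>0"
      using A5 l \<delta> by (simp add: \<theta>0_\<theta>1_\<gamma>0_def gamma0_def l_def)
    \<comment> \<open>\<open>\<gamma>0\<close> is scaled so that
      \<open>\<gamma>0 * ((\<alpha> * \<beta>)\<^sup>2 * l)\<close> is
      \<open>\<alpha> * \<bar>1 - \<beta>\<bar>\<close> times this factor.\<close>
    have "1 \<le> \<beta> / (1 - \<bar>1 - \<beta>\<bar>)" using \<delta>(1,2) by simp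
    then have "\<alpha> * \<bar>1 - \<beta>\<bar> * 1 \<le> \<alpha> * \<bar>1 - \<beta>\<bar> * (\<beta> / (1 - \<bar>1 - \<beta>\<bar>))"
      using A5(1) by (intro mult_left_mono) auto
    then have "\<alpha> * \<bar>1 - \<beta>\<bar> \<le> \<alpha> * \<bar>1 - \<beta>\<bar> * (\<beta> / (1 - \<bar>1 - \<beta>\<bar>))"
      by (simp only: mult_1_right)
    also have "\<dots> = \<gamma>0 * ((\<alpha> * \<beta>)\<^sup>2 * l)"
      using A5 l \<delta> by (simp add: \<theta>0_\<theta>1_\<gamma>0_def gamma0_def l_def[symmetric] field_simps power2_eq_square)
    finally have \<gamma>: "\<alpha> * \<bar>1 - \<beta>\<bar> \<le> \<gamma>0 * ((\<alpha> * \<beta>)\<^sup>2 * l)" .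
    have "\<alpha> * (1 - \<beta>) * (norm (\<rho> k))\<^sup>2 \<le> \<alpha> * \<bar>1 - \<beta>\<bar> * (norm (\<rho> k))\<^sup>2"
      using A5 by (intro mult_right_mono mult_left_mono) auto
    also have "\<dots> \<le> \<gamma>0 * ((\<alpha> * \<beta>)\<^sup>2 * l) * (norm (\<rho> k))\<^sup>2"
      using \<gamma> by (intro mult_right_mono) auto
    also have "\<dots> = \<gamma>0 * (\<alpha> * \<beta>)\<^sup>2 * (l * (norm (B *v u k))\<^sup>2)" by (simp add: u)
    also have "\<dots> \<le> \<gamma>0 * (\<alpha> * \<beta>)\<^sup>2 * (norm (transpose B *v (B *v u k)))\<^sup>2"
      unfolding l_def using \<gamma>0_nonneg by (intro mult_left_mono lambda_plus_transpose_le injB) auto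
    also have "\<dots> = \<gamma>0 * (norm (transpose B *v (z k - z j)))\<^sup>2"
      unfolding zd by (simp add: power_mult_distrib)
    also have "\<dots> \<le> r * \<gamma>0 * (norm (transpose B *v (z k - z j)))\<^sup>2"
      using \<gamma>0_nonneg r mult_right_mono[of 1 r \<gamma>0] by (intro mult_right_mono) auto
    finally have dz: "\<alpha> * (1 - \<beta>) * (norm (\<rho> k))\<^sup>2
        \<le> r * \<gamma>0 * (norm (transpose B *v (z k - z j)))\<^sup>2" .
    have "\<theta>0 \<le> r * \<theta>0" using r \<theta>0_nonneg mult_right_mono[of 1 r \<theta>0] by simp
    then have dyy: "2 * (Lh + q2)\<^sup>2 / a * (norm dy)\<^sup>2 \<le> r * \<theta>0 * (norm dy)\<^sup>2"
      using \<theta>0 by (intro mult_right_mono) auto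
    \<comment> \<open>Turns the penalty term into the budget
      \<open>a / 2 * (norm (u k))\<^sup>2\<close> of \<open>young_lower_bound\<close>.\<close>
    have "a * (norm (u k))\<^sup>2 \<le> \<alpha> * (norm (\<rho> k))\<^sup>2"
      using l(2)[of "u k"] A5(1) by (simp add: a_def u)
    moreover have "mh + a / 8 * (norm (u k))\<^sup>2 \<le> h (y k) - norm (grad h (y k)) * norm (u k)
        - (Lh + q2) * norm dy * norm (u k) + a / 2 * (norm (u k))\<^sup>2
        + 2 * (Lh + q2)\<^sup>2 / a * (norm dy)\<^sup>2"
      by (rule young_lower_bound[OF a grad_h])
    moreover have "(Lh + q2) * norm dy * norm (u k)
        = Lh * norm dy * norm (u k) + q2 * norm dy * norm (u k)" by (simp add: algebra_simps)
    moreover have "\<Phi> k = h (y k) + z k \<bullet> \<rho> k + \<alpha> / 2 * (norm (\<rho> k))\<^sup>2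
       + (r * \<gamma>0 * (norm (transpose B *v (z k - z j)))\<^sup>2 + r * \<theta>0 * (norm dy)\<^sup>2)"
      by (simp add: \<Phi>_def k dy_def)
    ultimately show ?thesis using zr Q G dz dyy by linarith
  qed

  \<comment> \<open>Bounds for x and for the residuals\<close>
  define C where "C = F k0 + g (x k0) + \<Phi> k0"
  have Fm: "mf \<le> F k" if "k0 \<le> k" for k
    using mf[of "x k"] F[of k] that k0 by simp
  have "g (x k) \<le> C - mf - mh" if "k0 \<le> k" for k
  proof -
    have "0 \<le> a / 8 * (norm (u k))\<^sup>2" using a by simp
    then show ?thesis using upper[OF that] lower[of k] Fm[OF that] that k0 by (simp add: C_def)
  qed
  then have "x ` {k0..} \<subseteq> {v. g v \<le> C - mf - mh}" by auto
  then have bx: "bounded (range x)"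
    by (intro bounded_range_tail bounded_subset[OF coercive_sublevel_bounded[OF A2(1)]])
  \<comment> \<open>The same inequality, now keeping the \<open>u\<close> term and replacing
    \<open>g\<close> by its lower bound.\<close>
  have "(norm (u k))\<^sup>2 \<le> 8 * (C - mf - mg - mh) / a" if "k0 \<le> k" for k
    using upper[OF that] lower[of k] Fm[OF that] mg[of "x k"] that k0 a
    by (simp add: C_def field_simps)
  then have "norm (u k) \<le> sqrt (8 * (C - mf - mg - mh) / a)" if "k0 \<le> k" for k
    using that by (simp add: real_le_rsqrt)
  then have bu: "bounded (range u)"
    by (intro bounded_range_tail[of _ k0]) (auto simp: bounded_iff)
  have "bounded ((*v) B ` range u)"
    by (intro bounded_linear_image bu matrix_vector_mul_bounded_linear)
  then have b\<rho>: "bounded (range \<rho>)" by (simp add: image_image u)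
  have bAx: "bounded ((*v) A ` range x)"
    by (intro bounded_linear_image bx matrix_vector_mul_bounded_linear)

  \<comment> \<open>Bound for y\<close>
  obtain Mx M\<rho> where M: "\<And>k. norm (A *v x k) \<le> Mx" "\<And>k. norm (\<rho> k) \<le> M\<rho>"
    using bAx b\<rho> by (auto simp: bounded_iff)
  have "norm (y k) \<le> sqrt ((M\<rho> + Mx + norm c)\<^sup>2 / l)" for k
  proof -
    have "B *v y k = \<rho> k - A *v x k - c" by (simp add: \<rho>_def residual_def)
    then have "norm (B *v y k) \<le> norm (\<rho> k) + norm (A *v x k) + norm c"
      using norm_triangle_ineq4[of "\<rho> k - A *v x k" c] norm_triangle_ineq4[of "\<rho> k" "A *v x k"]
      by simp
    then have "norm (B *v y k) \<le> M\<rho> + Mx + norm c" using M[of k] by linarith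
    then have "l * (norm (y k))\<^sup>2 \<le> (M\<rho> + Mx + norm c)\<^sup>2"
      using l(2)[of "y k"] by (meson norm_ge_zero order_trans power_mono)
    then show ?thesis using l(1) by (intro real_le_rsqrt) (simp add: field_simps)
  qed
  then obtain My where My: "\<And>k. norm (y k) \<le> My" by blast
  then have by': "bounded (range y)" by (auto simp: bounded_iff)

  \<comment> \<open>Bound for the multipliers\<close>
  have "bounded ((*v) (transpose B) ` range \<rho>)"
    by (intro bounded_linear_image b\<rho> matrix_vector_mul_bounded_linear)
  then obtain MB where MB: "\<And>k. norm (transpose B *v \<rho> k) \<le> MB"
    by (auto simp: bounded_iff)
  \<comment> \<open>The terms bound, in order, the gradient (two terms, Lipschitz from 0), the
    proximal term and the residual term of \<open>BT_z\<close>, and the shift by \<open>z 0\<close>.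
    As \<open>BT_z\<close> concerns successors, the estimate starts at index 1.\<close>
  define K where "K = norm (grad h 0) + Lh * My + q2 * (My + My) + \<alpha> * \<bar>1 - \<beta>\<bar> * MB
    + norm (transpose B *v z 0)"
  have "norm (s k) \<le> K / l" if k1: "1 \<le> k" for k
  proof -
    obtain j where k: "k = Suc j" using k1 by (cases k) auto
    have "norm (grad h (y j)) \<le> norm (grad h 0) + Lh * norm (y j)"
      using lipschitz_onD[OF A4(2), of "y j" 0] norm_triangle_ineq2[of "grad h (y j)" "grad h 0"]
      by (simp add: dist_norm)
    also have "\<dots> \<le> norm (grad h 0) + Lh * My" using My Lh by (simp add: mult_left_mono)
    finally have 1: "norm (grad h (y j)) \<le> norm (grad h 0) + Lh * My" .
    have "norm (Q2 j *v (y (Suc j) - y j)) \<le> q2 * norm (y (Suc j) - y j)"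
      unfolding q2_def by (intro norm_mult_le_Sup_mat_norm A5)
    also have "\<dots> \<le> q2 * (My + My)"
      using norm_triangle_ineq4[of "y (Suc j)" "y j"] My[of j] My[of "Suc j"] q2_nonneg
      by (intro mult_left_mono) auto
    finally have 2: "norm (Q2 j *v (y (Suc j) - y j)) \<le> q2 * (My + My)" .
    have 3: "norm ((\<alpha> * (1 - \<beta>)) *\<^sub>R (transpose B *v \<rho> (Suc j))) \<le> \<alpha> * \<bar>1 - \<beta>\<bar> * MB"
      using MB[of "Suc j"] A5(1) unfolding norm_scaleR abs_mult
      by (simp add: mult_left_mono)
    have "transpose B *v (B *v s k) = transpose B *v z k - transpose B *v z 0"
      unfolding s by (rule matrix_vector_mult_diff_distrib)
    then have "norm (transpose B *v (B *v s k))
        \<le> norm (transpose B *v z k) + norm (transpose B *v z 0)"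
      by (simp only: norm_triangle_ineq4)
    also have "norm (transpose B *v z k) \<le> norm (grad h (y j)) + norm (Q2 j *v (y (Suc j) - y j))
        + norm ((\<alpha> * (1 - \<beta>)) *\<^sub>R (transpose B *v \<rho> (Suc j)))"
    proof -
      have "norm (- p - q - w) \<le> norm p + norm q + norm w" for p q w :: "real ^ 'm"
        using norm_triangle_ineq4[of "- p - q" w] norm_triangle_ineq4[of "- p" q] by simp
      then show ?thesis unfolding k BT_z .
    qed
    finally have "norm (transpose B *v (B *v s k)) \<le> K" using 1 2 3 unfolding K_def by linarith
    then have "l * norm (s k) \<le> K"
      using lambda_plus_gram_norm_le[OF injB, of "s k"] unfolding l_def by (rule order_trans[rotated])
    then show ?thesis using l(1) by (simp add: field_simps)
  qed
  then have "bounded (range s)"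
    by (intro bounded_range_tail[of _ 1]) (auto simp: bounded_iff)
  then have "bounded ((*v) B ` range s)"
    by (intro bounded_linear_image matrix_vector_mul_bounded_linear)
  then have "bounded ((+) (z 0) ` (*v) B ` range s)" by (rule bounded_translation)
  then have bz: "bounded (range z)" by (simp add: image_image s)
  have "range (\<lambda>k. (x k, y k, z k)) \<subseteq> range x \<times> range y \<times> range z" by auto
  then show ?thesis
    by (rule bounded_subset[rotated]) (intro bounded_Times bx by' bz)
qed

end
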